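(* Let $\mathcal{M}=(E,r,m)$ be a ranked set with multiplicity. Then, as rational functions in $t,u_e,v_e$, $$\prod_{e\in E}(1-2v_e)\;\mathbf{Z}_{\mathcal{M}}\Bigl(t,\bigl(\tfrac{u_ev_e}{2v_e-1}\bigr)_{e\in E}\Bigr)=\sum_{A\subseteq E}(-1)^{|A|}\mathbf{Z}_{\mathcal{M}|A}\bigl(t,(u_e)_{e\in A}\bigr)\prod_{e\in A}v_e\prod_{e\in E\setminus A}(1-v_e).$$ Consequently, with $R=\mathbb{R}$ and $p_e\in[0,1]$, $$\mathbb{E}\bigl[(-1)^{|E_{\underline p}|}\mathbf{Z}_{\mathcal{M}|E_{\underline p}}(t,(u_e)_{e\in E_{\underline p}})\bigr]=\prod_{e\in E}(1-2p_e)\;\mathbf{Z}_{\mathcal{M}}\Bigl(t,\bigl(\tfrac{u_ep_e}{2p_e-1}\bigr)_{e\in E}\Bigr).$$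
   Context: A ranked set with multiplicity (rsm) is $\mathcal{M}=(E,r,m)$ with $E$ finite, $r:2^E\to\mathbb{Z}$ arbitrary ($r(\emptyset)$ may be nonzero), $m:2^E\to R$ arbitrary, $R$ a commutative ring with $1$. $\mathbf{Z}_{\mathcal{M}}(q,(v_e))=\sum_{A\subseteq E}m(A)q^{-r(A)}\prod_{e\in A}v_e$. Restriction $\mathcal{M}|A=(A,r|_{2^A},m|_{2^A})$. $E_{\underline p}$ is the random subset containing each $e$ independently with probability $p_e$. The right-hand side of the expectation formula equals the polynomial $\sum_{A\subseteq E}m(A)t^{-r(A)}\prod_{e\in A}(-u_ep_e)\prod_{e\in E\setminus A}(1-2p_e)$. *)

theory Defs
  imports "HOL-Probability.Probability" "HOL-Library.Poly_Mapping"
begin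

section \<open>The total ring of fractions of a commutative ring\<close>

text \<open>
  Since the coefficient ring may have zero divisors, the polynomial ring need not be an integral
  domain and the library type of fractions does not apply. Rational functions are therefore
  elements of the total ring of fractions, whose denominators are the elements that are not zero
  divisors; over an integral domain this is the field of fractions.
\<close>

definition nonzerodiv :: "'a::comm_ring_1 \<Rightarrow> bool" where
  "nonzerodiv b \<longleftrightarrow> (\<forall>x. b * x = 0 \<longrightarrow> x = 0)"

lemma nonzerodiv_1 [simp]: "nonzerodiv 1"
  by (simp add: nonzerodiv_def)

lemma nonzerodiv_mult [simp]: "nonzerodiv a \<Longrightarrow> nonzerodiv b \<Longrightarrow> nonzerodiv (a * b)"
  unfolding nonzerodiv_def mult.assoc by blast

lemma nonzerodiv_mult_right_iff:
  assumes "nonzerodiv b"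
  shows "nonzerodiv (a * b) \<longleftrightarrow> nonzerodiv a"
proof
  assume ab: "nonzerodiv (a * b)"
  show "nonzerodiv a"
    unfolding nonzerodiv_def
  proof (intro allI impI)
    fix x assume "a * x = 0"
    then have "b * (a * x) = 0" by simp
    then have "(a * b) * x = 0" by (simp only: ac_simps)
    then show "x = 0" using ab unfolding nonzerodiv_def by blast
  qed
qed (simp add: assms)

lemma nonzerodiv_cancel: "b * x = b * y \<longleftrightarrow> x = y" if "nonzerodiv b"
proof
  assume "b * x = b * y"
  then have "b * (x - y) = 0" by (simp only: right_diff_distrib diff_self)
  with \<open>nonzerodiv b\<close> have "x - y = 0" unfolding nonzerodiv_def by blast
  then show "x = y" by simp
qed simp

definition tfrac_rel :: "'a::comm_ring_1 \<times> 'a \<Rightarrow> 'a \<times> 'a \<Rightarrow> bool" where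
  "tfrac_rel x y \<longleftrightarrow> nonzerodiv (snd x) \<and> nonzerodiv (snd y) \<and> fst x * snd y = fst y * snd x"

lemma part_equivp_tfrac_rel: "part_equivp (tfrac_rel :: 'a::comm_ring_1 \<times> 'a \<Rightarrow> _)"
proof (rule part_equivpI)
  show "\<exists>x :: 'a \<times> 'a. tfrac_rel x x"
    by (rule exI[where x = "(0, 1)"]) (simp add: tfrac_rel_def)
  show "symp (tfrac_rel :: 'a \<times> 'a \<Rightarrow> _)"
    by (simp add: symp_def tfrac_rel_def)
  show "transp (tfrac_rel :: 'a \<times> 'a \<Rightarrow> _)"
  proof (rule transpI, unfold split_paired_all)
    fix a b c d e f :: 'a
    assume A: "tfrac_rel (a, b) (c, d)" and B: "tfrac_rel (c, d) (e, f)"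
    have "d * (a * f) = (a * d) * f" by (simp add: ac_simps)
    also have "\<dots> = (c * b) * f" using A by (simp add: tfrac_rel_def)
    also have "\<dots> = (c * f) * b" by (simp add: ac_simps)
    also have "\<dots> = (e * d) * b" using B by (simp add: tfrac_rel_def)
    also have "\<dots> = d * (e * b)" by (simp add: ac_simps)
    finally show "tfrac_rel (a, b) (e, f)"
      using A B by (simp add: tfrac_rel_def nonzerodiv_cancel)
  qed
qed

quotient_type (overloaded) 'a tfrac = "'a::comm_ring_1 \<times> 'a" / partial: "tfrac_rel"
  by (rule part_equivp_tfrac_rel)

instantiation tfrac :: (comm_ring_1) comm_ring_1
begin

lift_definition zero_tfrac :: "'a tfrac" is "(0, 1)" by (simp add: tfrac_rel_def)

lift_definition one_tfrac :: "'a tfrac" is "(1, 1)" by (simp add: tfrac_rel_def)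

lift_definition plus_tfrac :: "'a tfrac \<Rightarrow> 'a tfrac \<Rightarrow> 'a tfrac"
  is "\<lambda>x y. (fst x * snd y + fst y * snd x, snd x * snd y)"
proof -
  fix x x' y y' :: "'a \<times> 'a"
  assume "tfrac_rel x x'" "tfrac_rel y y'"
  then have nz: "nonzerodiv (snd x)" "nonzerodiv (snd x')" "nonzerodiv (snd y)" "nonzerodiv (snd y')"
    and x: "fst x * snd x' = fst x' * snd x" and y: "fst y * snd y' = fst y' * snd y"
    by (auto simp: tfrac_rel_def)
  have "(fst x * snd y + fst y * snd x) * (snd x' * snd y') =
      (fst x * snd x') * (snd y * snd y') + (fst y * snd y') * (snd x * snd x')"
    by (simp add: algebra_simps)
  also have "\<dots> = (fst x' * snd y' + fst y' * snd x') * (snd x * snd y)"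
    unfolding x y by (simp add: algebra_simps)
  finally show "tfrac_rel (fst x * snd y + fst y * snd x, snd x * snd y)
      (fst x' * snd y' + fst y' * snd x', snd x' * snd y')"
    using nz by (simp add: tfrac_rel_def)
qed

lift_definition uminus_tfrac :: "'a tfrac \<Rightarrow> 'a tfrac" is "\<lambda>x. (- fst x, snd x)"
  by (simp add: tfrac_rel_def)

definition minus_tfrac :: "'a tfrac \<Rightarrow> 'a tfrac \<Rightarrow> 'a tfrac" where
  "minus_tfrac x y = x + - y"

lift_definition times_tfrac :: "'a tfrac \<Rightarrow> 'a tfrac \<Rightarrow> 'a tfrac"
  is "\<lambda>x y. (fst x * fst y, snd x * snd y)"
proof -
  fix x x' y y' :: "'a \<times> 'a"
  assume "tfrac_rel x x'" "tfrac_rel y y'"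
  then have nz: "nonzerodiv (snd x)" "nonzerodiv (snd x')" "nonzerodiv (snd y)" "nonzerodiv (snd y')"
    and x: "fst x * snd x' = fst x' * snd x" and y: "fst y * snd y' = fst y' * snd y"
    by (auto simp: tfrac_rel_def)
  have "(fst x * fst y) * (snd x' * snd y') = (fst x * snd x') * (fst y * snd y')"
    by (simp add: ac_simps)
  also have "\<dots> = (fst x' * fst y') * (snd x * snd y)"
    unfolding x y by (simp add: ac_simps)
  finally show "tfrac_rel (fst x * fst y, snd x * snd y) (fst x' * fst y', snd x' * snd y')"
    using nz by (simp add: tfrac_rel_def)
qed

instance
proof
  fix x y z :: "'a tfrac"
  show "(x * y) * z = x * (y * z)"
    by transfer (auto simp: tfrac_rel_def algebra_simps)
  show "x * y = y * x"
    by transfer (auto simp: tfrac_rel_def algebra_simps)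
  show "1 * x = x"
    by transfer (auto simp: tfrac_rel_def)
  show "(x + y) + z = x + (y + z)"
    by transfer (auto simp: tfrac_rel_def algebra_simps)
  show "x + y = y + x"
    by transfer (auto simp: tfrac_rel_def algebra_simps)
  show "0 + x = x"
    by transfer (auto simp: tfrac_rel_def)
  show "- x + x = 0"
    by transfer (auto simp: tfrac_rel_def)
  show "x - y = x + - y"
    by (rule minus_tfrac_def)
  show "(x + y) * z = x * z + y * z"
    by transfer (auto simp: tfrac_rel_def algebra_simps)
  show "(0 :: 'a tfrac) \<noteq> 1"
    by transfer (auto simp: tfrac_rel_def)
qed

end

text \<open>
  An element \<open>a / b\<close> is a unit iff \<open>a\<close> is not a zero divisor; as for fields in the library, the
  inverse is \<open>0\<close> on the remaining elements.
\<close>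

instantiation tfrac :: (comm_ring_1) inverse
begin

lift_definition inverse_tfrac :: "'a tfrac \<Rightarrow> 'a tfrac"
  is "\<lambda>x. if nonzerodiv (fst x) then (snd x, fst x) else (0, 1)"
proof -
  fix x y :: "'a \<times> 'a"
  assume "tfrac_rel x y"
  then have nz: "nonzerodiv (snd x)" "nonzerodiv (snd y)" and eq: "fst x * snd y = fst y * snd x"
    by (auto simp: tfrac_rel_def)
  have "nonzerodiv (fst x) \<longleftrightarrow> nonzerodiv (fst y)"
    using nonzerodiv_mult_right_iff[OF nz(1), of "fst y"] nonzerodiv_mult_right_iff[OF nz(2), of "fst x"] eq
    by simp
  then show "tfrac_rel (if nonzerodiv (fst x) then (snd x, fst x) else (0, 1))
      (if nonzerodiv (fst y) then (snd y, fst y) else (0, 1))"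
    using nz eq by (simp add: tfrac_rel_def mult.commute)
qed

definition divide_tfrac :: "'a tfrac \<Rightarrow> 'a tfrac \<Rightarrow> 'a tfrac" where
  "divide_tfrac x y = x * inverse y"

instance ..

end

lift_definition to_tfrac :: "'a::comm_ring_1 \<Rightarrow> 'a tfrac" is "\<lambda>a. (a, 1)"
  by (simp add: tfrac_rel_def)

lemma to_tfrac_eq_iff: "to_tfrac a = to_tfrac b \<longleftrightarrow> a = b"
  by transfer (simp add: tfrac_rel_def)

lemma to_tfrac_mult_inverse:
  "nonzerodiv a \<Longrightarrow> to_tfrac a * inverse (to_tfrac a) = 1"
  by transfer (auto simp: tfrac_rel_def)

section \<open>Rational functions in the indeterminates \<open>t\<close>, \<open>u\<^sub>e\<close>, \<open>v\<^sub>e\<close>\<close>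

datatype 'e indet = T | U 'e | V 'e

type_synonym ('e, 'r) mpoly = "('e indet \<Rightarrow>\<^sub>0 nat) \<Rightarrow>\<^sub>0 'r"

type_synonym ('e, 'r) ratfun = "('e, 'r) mpoly tfrac"

definition mpoly_var :: "'e indet \<Rightarrow> ('e, 'r::comm_ring_1) mpoly" where
  "mpoly_var x = Poly_Mapping.single (Poly_Mapping.single x 1) 1"

text \<open>The denominators occurring below are genuine denominators:\<close>

lemma nonzerodiv_two_var_minus_one: "nonzerodiv (2 * mpoly_var x - 1 :: ('e, 'r::comm_ring_1) mpoly)"
  unfolding nonzerodiv_def
proof (intro allI impI)
  fix f :: "('e, 'r) mpoly"
  assume "(2 * mpoly_var x - 1) * f = 0"
  then have f: "f = mpoly_var x * (2 * f)" by (simp add: algebra_simps)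
  have ge: "n \<le> Poly_Mapping.lookup k x" if "k \<in> Poly_Mapping.keys f" for n k
    using that
  proof (induction n arbitrary: k)
    case (Suc n)
    have "k \<in> Poly_Mapping.keys (mpoly_var x * (f + f))" using Suc.prems f by (metis mult_2)
    then obtain a b where k: "k = a + b" "a \<in> Poly_Mapping.keys (mpoly_var x :: ('e,'r) mpoly)" "b \<in> Poly_Mapping.keys (f + f)"
      using keys_mult by blast
    have "a = Poly_Mapping.single x 1" using k(2) by (simp add: mpoly_var_def)
    moreover have "b \<in> Poly_Mapping.keys f" using k(3) Poly_Mapping.keys_add[of f f] by blast
    ultimately show ?case using Suc.IH[of b] k(1) by (simp add: lookup_add)
  qed simp
  have "Poly_Mapping.keys f = {}" using ge[of _ "Suc (Poly_Mapping.lookup _ x)"] by (meson all_not_in_conv not_less_eq_eq order_refl)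
  then show "f = 0" by simp
qed

lemma nonzerodiv_var: "nonzerodiv (mpoly_var x :: ('e, 'r::comm_ring_1) mpoly)"
  unfolding nonzerodiv_def
proof (intro allI impI)
  fix f :: "('e, 'r) mpoly"
  let ?s = "Poly_Mapping.single x (1::nat)"
  assume 0: "mpoly_var x * f = 0"
  have "Poly_Mapping.lookup (mpoly_var x * f) (?s + k) = Poly_Mapping.lookup f k" for k
  proof -
    have "Poly_Mapping.lookup (mpoly_var x * f) (?s + k) =
      (\<Sum>l. Poly_Mapping.lookup (mpoly_var x :: ('e,'r) mpoly) l * (\<Sum>q. Poly_Mapping.lookup f q when ?s + k = l + q))"
      by (simp add: lookup_mult)
    also have "\<dots> = (\<Sum>l. (\<Sum>q. Poly_Mapping.lookup f q when ?s + k = l + q) when l = ?s)"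
      by (intro Sum_any.cong) (auto simp: mpoly_var_def lookup_single when_def)
    also have "\<dots> = Poly_Mapping.lookup f k" by simp
    finally show ?thesis .
  qed
  then show "f = 0" using 0 by (metis lookup_zero poly_mapping_eqI)
qed
definition rf_const :: "'r::comm_ring_1 \<Rightarrow> ('e, 'r) ratfun" where
  "rf_const c = to_tfrac (Poly_Mapping.single 0 c)"

definition rf_var :: "'e indet \<Rightarrow> ('e, 'r::comm_ring_1) ratfun" where
  "rf_var x = to_tfrac (mpoly_var x)"

section \<open>Ranked sets with multiplicity\<close>

text \<open>The rank and multiplicity functions are only relevant on subsets of the ground set.\<close>

record ('e, 'r) rsm =
  ground :: "'e set"
  rk :: "'e set \<Rightarrow> int"
  mult :: "'e set \<Rightarrow> 'r"

definition is_rsm :: "('e, 'r::comm_ring_1) rsm \<Rightarrow> bool" where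
  "is_rsm M \<longleftrightarrow> finite (ground M)"

definition rsm_restrict :: "('e, 'r) rsm \<Rightarrow> 'e set \<Rightarrow> ('e, 'r) rsm" where
  "rsm_restrict M A =
     \<lparr>ground = A, rk = restrict (rk M) (Pow A), mult = restrict (mult M) (Pow A)\<rparr>"

text \<open>
  The partition function is evaluated in a ring extending the coefficient ring along \<open>\<iota>\<close>, so that
  the same definition serves for rational functions and for real values.
\<close>

definition partition_fun ::
    "('r::comm_ring_1 \<Rightarrow> 's::{comm_ring_1, inverse}) \<Rightarrow> ('e, 'r) rsm \<Rightarrow> 's \<Rightarrow> ('e \<Rightarrow> 's) \<Rightarrow> 's" where
  "partition_fun \<iota> M q v =
     (\<Sum>A\<in>Pow (ground M). \<iota> (mult M A) * q powi (- rk M A) * (\<Prod>e\<in>A. v e))"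

definition random_subset :: "'e set \<Rightarrow> ('e \<Rightarrow> real) \<Rightarrow> 'e set pmf" where
  "random_subset E p =
     map_pmf (\<lambda>f. {e \<in> E. f e}) (Pi_pmf E False (\<lambda>e. bernoulli_pmf (p e)))"

end

theory Submission
  imports Defs
begin

text \<open>
  Exchanging the sums over \<open>B \<subseteq> A \<subseteq> E\<close> and writing \<open>A = B \<union> C\<close>, the inner sum over \<open>C \<subseteq> E - B\<close> is the
  expansion of \<open>\<Prod>\<^bsub>e\<in>E - B\<^esub> (- v\<^sub>e + (1 - v\<^sub>e))\<close>, so each \<open>B\<close> contributes
  \<open>m(B) t\<^bsup>-r(B)\<^esup> \<Prod>\<^bsub>e\<in>B\<^esub> (- u\<^sub>e v\<^sub>e) \<Prod>\<^bsub>e\<in>E - B\<^esub> (1 - 2 v\<^sub>e)\<close>. This is a ring identity, so it serves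
  rational functions and real values alike, including \<open>p\<^sub>e = 1/2\<close>.
\<close>

text \<open>The map \<open>(A, B) \<mapsto> (B, A - B)\<close> is a bijection from the nested pairs
  \<open>B \<subseteq> A\<close> of subsets of \<open>E\<close> to the disjoint pairs, with inverse
  \<open>(B, C) \<mapsto> (B \<union> C, B)\<close>.\<close>

lemma sum_Pow_Pow_swap:
  fixes F :: "'e set \<Rightarrow> 'e set \<Rightarrow> 'a::comm_monoid_add"
  assumes "finite E"
  shows "(\<Sum>A\<in>Pow E. \<Sum>B\<in>Pow A. F A B) = (\<Sum>B\<in>Pow E. \<Sum>C\<in>Pow (E - B). F (B \<union> C) B)"
proof -
  have fin: "finite A" if "A \<subseteq> E" for A
    using assms that by (rule finite_subset[rotated])
  have "(\<Sum>A\<in>Pow E. \<Sum>B\<in>Pow A. F A B) = (\<Sum>(A, B)\<in>(SIGMA A:Pow E. Pow A). F A B)"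
    using assms fin by (intro sum.Sigma) auto
  also have "\<dots> = (\<Sum>(B, C)\<in>(SIGMA B:Pow E. Pow (E - B)). F (B \<union> C) B)"
    by (rule sum.reindex_bij_witness[where i = "\<lambda>(B, C). (B \<union> C, B)" and j = "\<lambda>(A, B). (B, A - B)"])
      (auto simp: Un_absorb1)
  also have "\<dots> = (\<Sum>B\<in>Pow E. \<Sum>C\<in>Pow (E - B). F (B \<union> C) B)"
    using assms by (intro sum.Sigma[symmetric]) auto
  finally show ?thesis .
qed

text \<open>The factor \<open>q powi (- rk M B)\<close> stays opaque throughout, so only ring
  arithmetic is involved and \<open>tfrac\<close> and \<open>real\<close> can share the
  result.\<close>

lemma alternating_sum_partition_fun_restrict:
  fixes \<iota> :: "'r::comm_ring_1 \<Rightarrow> 's::{comm_ring_1, inverse}" and M :: "('e, 'r) rsm"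
  assumes "is_rsm M"
  shows "(\<Sum>A\<in>Pow (ground M). (-1) ^ card A * partition_fun \<iota> (rsm_restrict M A) q u *
             (\<Prod>e\<in>A. v e) * (\<Prod>e\<in>ground M - A. 1 - v e))
       = (\<Sum>B\<in>Pow (ground M). \<iota> (mult M B) * q powi (- rk M B) *
             (\<Prod>e\<in>B. - (u e * v e)) * (\<Prod>e\<in>ground M - B. 1 - 2 * v e))"
proof -
  define E where "E = ground M"
  define f where "f B = \<iota> (mult M B) * q powi (- rk M B)" for B
  have fin: "finite E"
    using assms by (simp add: is_rsm_def E_def)
  have "(\<Sum>A\<in>Pow E. (-1) ^ card A * partition_fun \<iota> (rsm_restrict M A) q u *
            (\<Prod>e\<in>A. v e) * (\<Prod>e\<in>E - A. 1 - v e))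
      = (\<Sum>A\<in>Pow E. \<Sum>B\<in>Pow A.
            f B * (\<Prod>e\<in>B. u e) * (\<Prod>e\<in>A. - v e) * (\<Prod>e\<in>E - A. 1 - v e))"
  proof (rule sum.cong[OF refl])
    fix A
    \<comment> \<open>Only subsets of \<open>A\<close> are summed over, and there the restricted
      rank and multiplicity agree with the original ones.\<close>
    have "partition_fun \<iota> (rsm_restrict M A) q u = (\<Sum>B\<in>Pow A. f B * (\<Prod>e\<in>B. u e))"
      by (simp add: partition_fun_def rsm_restrict_def f_def)
    then have "(-1) ^ card A * partition_fun \<iota> (rsm_restrict M A) q u *
            (\<Prod>e\<in>A. v e) * (\<Prod>e\<in>E - A. 1 - v e)
        = (\<Sum>B\<in>Pow A. f B * (\<Prod>e\<in>B. u e)) * ((-1) ^ card A * (\<Prod>e\<in>A. v e)) *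
            (\<Prod>e\<in>E - A. 1 - v e)"
      by (simp only: ac_simps)
    \<comment> \<open>The sign is distributed over the elements of \<open>A\<close>, turning each
      \<open>v e\<close> into \<open>- v e\<close>.\<close>
    then show "(-1) ^ card A * partition_fun \<iota> (rsm_restrict M A) q u *
            (\<Prod>e\<in>A. v e) * (\<Prod>e\<in>E - A. 1 - v e)
        = (\<Sum>B\<in>Pow A. f B * (\<Prod>e\<in>B. u e) * (\<Prod>e\<in>A. - v e) * (\<Prod>e\<in>E - A. 1 - v e))"
      by (simp only: prod_uminus sum_distrib_right)
  qed
  also have "\<dots> = (\<Sum>B\<in>Pow E. \<Sum>C\<in>Pow (E - B). f B * (\<Prod>e\<in>B. u e) *
            (\<Prod>e\<in>B \<union> C. - v e) * (\<Prod>e\<in>E - (B \<union> C). 1 - v e))"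
    by (rule sum_Pow_Pow_swap[OF fin])
  also have "\<dots> = (\<Sum>B\<in>Pow E. f B * (\<Prod>e\<in>B. - (u e * v e)) * (\<Prod>e\<in>E - B. 1 - 2 * v e))"
  proof (rule sum.cong[OF refl])
    fix B assume "B \<in> Pow E"
    then have finB: "finite B"
      using fin finite_subset by blast
    have "(\<Sum>C\<in>Pow (E - B). f B * (\<Prod>e\<in>B. u e) *
            (\<Prod>e\<in>B \<union> C. - v e) * (\<Prod>e\<in>E - (B \<union> C). 1 - v e))
        = (\<Sum>C\<in>Pow (E - B). f B * ((\<Prod>e\<in>B. u e) * (\<Prod>e\<in>B. - v e)) *
            ((\<Prod>e\<in>C. - v e) * (\<Prod>e\<in>E - B - C. 1 - v e)))"
    proof (rule sum.cong[OF refl])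
      fix C assume "C \<in> Pow (E - B)"
      then have "finite C" "B \<inter> C = {}"
        using fin finite_subset[of C E] by auto
      then have "(\<Prod>e\<in>B \<union> C. - v e) = (\<Prod>e\<in>B. - v e) * (\<Prod>e\<in>C. - v e)"
        using finB by (intro prod.union_disjoint)
      moreover have "E - (B \<union> C) = E - B - C"
        by blast
      ultimately show "f B * (\<Prod>e\<in>B. u e) * (\<Prod>e\<in>B \<union> C. - v e) * (\<Prod>e\<in>E - (B \<union> C). 1 - v e)
          = f B * ((\<Prod>e\<in>B. u e) * (\<Prod>e\<in>B. - v e)) *
            ((\<Prod>e\<in>C. - v e) * (\<Prod>e\<in>E - B - C. 1 - v e))"
        by (simp only: ac_simps)
    qed
    \<comment> \<open>\<open>prod_add\<close>, read from right to left, collapses the sum over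
      \<open>C\<close> into a product of two-term factors.\<close>
    also have "\<dots> = f B * (\<Prod>e\<in>B. - (u e * v e)) * (\<Prod>e\<in>E - B. - v e + (1 - v e))"
      using fin by (simp only: sum_distrib_left prod_add finite_Diff)
        (simp flip: prod.distrib)
    finally show "(\<Sum>C\<in>Pow (E - B). f B * (\<Prod>e\<in>B. u e) *
            (\<Prod>e\<in>B \<union> C. - v e) * (\<Prod>e\<in>E - (B \<union> C). 1 - v e))
        = f B * (\<Prod>e\<in>B. - (u e * v e)) * (\<Prod>e\<in>E - B. 1 - 2 * v e)"
      by (simp add: algebra_simps)
  qed
  finally show ?thesis
    by (simp only: E_def f_def)
qed

text \<open>Clearing denominators: in the term of \<open>B\<close>, the factors \<open>d e\<close>
  with \<open>e \<in> B\<close> are absorbed by \<open>w e\<close>, and the others survive. Writing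
  the hypothesis as \<open>d e * w e = x e\<close> avoids division, so it fits \<open>tfrac\<close>,
  which need not be a field.\<close>

lemma prod_mult_partition_fun:
  fixes \<iota> :: "'r::comm_ring_1 \<Rightarrow> 's::{comm_ring_1, inverse}" and M :: "('e, 'r) rsm"
  assumes "is_rsm M" and w: "\<And>e. e \<in> ground M \<Longrightarrow> d e * w e = x e"
  shows "(\<Prod>e\<in>ground M. d e) * partition_fun \<iota> M q w
       = (\<Sum>B\<in>Pow (ground M). \<iota> (mult M B) * q powi (- rk M B) *
             (\<Prod>e\<in>B. x e) * (\<Prod>e\<in>ground M - B. d e))"
  unfolding partition_fun_def sum_distrib_left
proof (rule sum.cong[OF refl])
  fix B assume "B \<in> Pow (ground M)"
  then have B: "B \<subseteq> ground M" by simp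
  then have "(\<Prod>e\<in>ground M. d e) = (\<Prod>e\<in>ground M - B. d e) * (\<Prod>e\<in>B. d e)"
    using assms(1) by (intro prod.subset_diff) (simp_all add: is_rsm_def)
  moreover have "(\<Prod>e\<in>B. x e) = (\<Prod>e\<in>B. d e) * (\<Prod>e\<in>B. w e)"
    unfolding prod.distrib[symmetric] using B w by (intro prod.cong) auto
  ultimately show "(\<Prod>e\<in>ground M. d e) * (\<iota> (mult M B) * q powi (- rk M B) * (\<Prod>e\<in>B. w e))
      = \<iota> (mult M B) * q powi (- rk M B) * (\<Prod>e\<in>B. x e) * (\<Prod>e\<in>ground M - B. d e)"
    by (simp only: ac_simps)
qed

lemma to_tfrac_mult: "to_tfrac (a * b) = to_tfrac a * to_tfrac b"
  by transfer (simp add: tfrac_rel_def)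

lemma to_tfrac_diff: "to_tfrac (a - b) = to_tfrac a - to_tfrac b"
  unfolding minus_tfrac_def by transfer (simp add: tfrac_rel_def)

lemma to_tfrac_1: "to_tfrac 1 = 1"
  by transfer (simp add: tfrac_rel_def)

lemma to_tfrac_2: "to_tfrac 2 = 2"
proof -
  have "to_tfrac (1 + 1 :: 'a) = 1 + 1"
    by transfer (simp add: tfrac_rel_def)
  then show ?thesis by simp
qed

text \<open>The element is the image of a polynomial that is not a zero divisor, so its
  \<open>inverse\<close> is a genuine one and not the default value 0.\<close>

lemma two_rf_var_minus_one_mult_inverse:
  "(2 * rf_var x - 1) * inverse (2 * rf_var x - 1 :: ('e, 'r::comm_ring_1) ratfun) = 1"
proof -
  have "2 * rf_var x - 1 = (to_tfrac (2 * mpoly_var x - 1) :: ('e, 'r) ratfun)"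
    by (simp add: rf_var_def to_tfrac_mult to_tfrac_diff to_tfrac_1 to_tfrac_2)
  then show ?thesis
    by (simp only: to_tfrac_mult_inverse[OF nonzerodiv_two_var_minus_one])
qed

lemma set_pmf_random_subset: "set_pmf (random_subset E p) \<subseteq> Pow E"
  by (auto simp: random_subset_def)

lemma pmf_random_subset:
  assumes "finite E" "A \<subseteq> E" "\<And>e. e \<in> E \<Longrightarrow> 0 \<le> p e \<and> p e \<le> 1"
  shows "pmf (random_subset E p) A = (\<Prod>e\<in>A. p e) * (\<Prod>e\<in>E - A. 1 - p e)"
proof -
  \<comment> \<open>Here \<open>{e \<in> A}\<close> is the singleton of a truth value: the event
    prescribes every coordinate separately, so independence gives a product.\<close>
  have "(\<lambda>f. {e \<in> E. f e}) -` {A} = Pi E (\<lambda>e. {e \<in> A})"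
    using assms(2) by (auto simp: Pi_def)
  then have "pmf (random_subset E p) A = (\<Prod>e\<in>E. pmf (bernoulli_pmf (p e)) (e \<in> A))"
    using assms(1) by (simp add: random_subset_def pmf_map measure_Pi_pmf_Pi measure_pmf_single)
  also have "\<dots> = (\<Prod>e\<in>E - A. pmf (bernoulli_pmf (p e)) (e \<in> A)) *
      (\<Prod>e\<in>A. pmf (bernoulli_pmf (p e)) (e \<in> A))"
    using assms by (intro prod.subset_diff) auto
  also have "\<dots> = (\<Prod>e\<in>E - A. 1 - p e) * (\<Prod>e\<in>A. p e)"
    \<comment> \<open>The bounds on \<open>p e\<close> ensure that the Bernoulli masses are
      \<open>p e\<close> and \<open>1 - p e\<close>.\<close>
    using assms(2,3) by (intro arg_cong2[where f = "(*)"] prod.cong) auto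
  finally show ?thesis
    by (simp only: mult.commute)
qed

lemma expectation_random_subset:
  fixes g :: "'e set \<Rightarrow> real"
  assumes "finite E" "\<And>e. e \<in> E \<Longrightarrow> 0 \<le> p e \<and> p e \<le> 1"
  shows "measure_pmf.expectation (random_subset E p) g
       = (\<Sum>A\<in>Pow E. g A * (\<Prod>e\<in>A. p e) * (\<Prod>e\<in>E - A. 1 - p e))"
proof -
  have "measure_pmf.expectation (random_subset E p) g = (\<Sum>A\<in>Pow E. pmf (random_subset E p) A * g A)"
    using assms(1) set_pmf_random_subset[of E p]
    by (subst integral_measure_pmf[of "Pow E"]) auto
  also have "\<dots> = (\<Sum>A\<in>Pow E. g A * (\<Prod>e\<in>A. p e) * (\<Prod>e\<in>E - A. 1 - p e))"
    using assms by (intro sum.cong) (auto simp: pmf_random_subset)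
  finally show ?thesis .
qed

text \<open>The expectation is first equated with a polynomial in \<open>u\<close> and
  \<open>p\<close>, which makes sense also at \<open>p e = 1 / 2\<close>; the quotient form is
  asserted where its denominators do not vanish.\<close>

theorem theorem4p7:
  fixes M :: "('e, 'r::comm_ring_1) rsm"
  assumes "is_rsm M"
  shows
    "((\<Prod>e\<in>ground M. 1 - 2 * rf_var (V e)) *
        partition_fun rf_const M (rf_var T)
          (\<lambda>e. rf_var (U e) * rf_var (V e) / (2 * rf_var (V e) - 1))
      = (\<Sum>A\<in>Pow (ground M).
          (-1) ^ card A * partition_fun rf_const (rsm_restrict M A) (rf_var T) (\<lambda>e. rf_var (U e)) *
          (\<Prod>e\<in>A. rf_var (V e)) * (\<Prod>e\<in>ground M - A. 1 - rf_var (V e)) :: ('e, 'r) ratfun))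
     \<and>
     (\<forall>(N :: ('e, real) rsm) (t :: real) (u :: 'e \<Rightarrow> real) (p :: 'e \<Rightarrow> real).
        is_rsm N \<and> t \<noteq> 0 \<and> (\<forall>e\<in>ground N. 0 \<le> p e \<and> p e \<le> 1) \<longrightarrow>
          measure_pmf.expectation (random_subset (ground N) p)
              (\<lambda>A. (-1) ^ card A * partition_fun id (rsm_restrict N A) t u)
            = (\<Sum>A\<in>Pow (ground N). mult N A * t powi (- rk N A) *
                 (\<Prod>e\<in>A. - (u e * p e)) * (\<Prod>e\<in>ground N - A. 1 - 2 * p e)) \<and>
          ((\<forall>e\<in>ground N. p e \<noteq> 1 / 2) \<longrightarrow>
            measure_pmf.expectation (random_subset (ground N) p)
                (\<lambda>A. (-1) ^ card A * partition_fun id (rsm_restrict N A) t u)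
              = (\<Prod>e\<in>ground N. 1 - 2 * p e) *
                partition_fun id N t (\<lambda>e. u e * p e / (2 * p e - 1))))"
proof (intro conjI allI impI; (elim conjE)?)
  let ?w = "\<lambda>e. rf_var (U e) * rf_var (V e) / (2 * rf_var (V e) - 1) :: ('e, 'r) ratfun"
  have "(1 - 2 * rf_var (V e)) * ?w e = - (rf_var (U e) * rf_var (V e))" for e
  proof -
    \<comment> \<open>The prefactor is the negative of the denominator, which is the source of the
      minus sign.\<close>
    have "(1 - 2 * rf_var (V e)) * ?w e = - (rf_var (U e) * rf_var (V e) *
        ((2 * rf_var (V e) - 1) * inverse (2 * rf_var (V e) - 1)))"
      by (simp add: divide_tfrac_def algebra_simps)
    then show ?thesis
      by (simp only: two_rf_var_minus_one_mult_inverse mult_1_right)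
  qed
  then show "(\<Prod>e\<in>ground M. 1 - 2 * rf_var (V e)) * partition_fun rf_const M (rf_var T) ?w
      = (\<Sum>A\<in>Pow (ground M).
          (-1) ^ card A * partition_fun rf_const (rsm_restrict M A) (rf_var T) (\<lambda>e. rf_var (U e)) *
          (\<Prod>e\<in>A. rf_var (V e)) * (\<Prod>e\<in>ground M - A. 1 - rf_var (V e)))"
    \<comment> \<open>Both sides are brought to the same sum over \<open>B\<close>: the right one by
      exchanging sums, the left one by clearing denominators.\<close>
    unfolding alternating_sum_partition_fun_restrict[OF assms]
    by (intro prod_mult_partition_fun[OF assms])
next
  fix N :: "('e, real) rsm" and t :: real and u p :: "'e \<Rightarrow> real"
  assume N: "is_rsm N" and p: "\<forall>e\<in>ground N. 0 \<le> p e \<and> p e \<le> 1"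
  show E: "measure_pmf.expectation (random_subset (ground N) p)
          (\<lambda>A. (-1) ^ card A * partition_fun id (rsm_restrict N A) t u)
      = (\<Sum>A\<in>Pow (ground N). mult N A * t powi (- rk N A) *
           (\<Prod>e\<in>A. - (u e * p e)) * (\<Prod>e\<in>ground N - A. 1 - 2 * p e))"
    \<comment> \<open>The probability of drawing \<open>A\<close> is exactly the weight in the
      alternating sum at \<open>v = p\<close>.\<close>
    using N p alternating_sum_partition_fun_restrict[OF N, of id t u p]
    by (subst expectation_random_subset) (auto simp: is_rsm_def)
  assume half: "\<forall>e\<in>ground N. p e \<noteq> 1 / 2"
  \<comment> \<open>At \<open>p e = 1 / 2\<close> the left side would be 0 but the right side
    \<open>- (u e / 2)\<close>, hence the exclusion.\<close>
  have "(1 - 2 * p e) * (u e * p e / (2 * p e - 1)) = - (u e * p e)" if "e \<in> ground N" for e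
    using half that by (auto simp: field_simps)
  from prod_mult_partition_fun[OF N this, where \<iota> = id and q = t]
  show "measure_pmf.expectation (random_subset (ground N) p)
          (\<lambda>A. (-1) ^ card A * partition_fun id (rsm_restrict N A) t u)
      = (\<Prod>e\<in>ground N. 1 - 2 * p e) * partition_fun id N t (\<lambda>e. u e * p e / (2 * p e - 1))"
    unfolding E by simp
qed

end
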